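(* Let $s$ be a weak composition. The $s$-weak order $\preccurlyeq$ on $s$-decreasing trees is a lattice. The join of two $s$-decreasing trees $T$ and $R$ is the $s$-decreasing tree $T\vee R$ given by $$\operatorname{inv}(T\vee R)=\bigl(\operatorname{inv}(T)\cup\operatorname{inv}(R)\bigr)^{\mathsf{tc}}.$$
   Context: A weak composition is a finite sequence $s=(s(1),\dots,s(n))$ of nonnegative integers. An $s$-decreasing tree is a rooted planar tree with exactly $n$ internal nodes, labelled bijectively by $1,\dots,n$ (an internal node is identified with its label; the other nodes are unlabelled leaves), such that internal node $i$ has exactly $s(i)+1$ ordered children and all internal nodes that are descendants of $i$ have labels smaller than $i$. For a node $y$ of $T$, $T^y_0,\dots,T^y_{s(y)}$ denote its child subtrees from left to right, and $x\in T^y_i$ means that internal node $x$ lies in that subtree. If $x<y$ and $x$ is not a descendant of $y$, let $z$ be the first (closest) common ancestor of $x$ and $y$, with $x\in T^z_j$, $y\in T^z_i$, $i\neq j$; $x$ is left of $y$ if $j<i$ and right of $y$ if $j>i$. For $x<y$ the cardinality $\#_T(y,x)$ is: $0$ if $x$ is left of $y$; $i$ if $x\in T^y_i$; $s(y)$ if $x$ is right of $y$. The multiset of tree-inversions $\operatorname{inv}(T)$ is the multiset of pairs $(y,x)$, $1\le x<y\le n$, where $(y,x)$ has multiplicity $\#_T(y,x)$; $T$ is determined by $\operatorname{inv}(T)$. The $s$-weak order is defined by $R\preccurlyeq T$ iff $\#_R(y,x)\le \#_T(y,x)$ for all $1\le x<y\le n$. A multi inversion set $I$ is a multiset of pairs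 $(y,x)$ with $1\le x<y\le n$; $\#_I(y,x)$ is the multiplicity of $(y,x)$. The union is given by $\#_{I\cup J}(y,x)=\max(\#_I(y,x),\#_J(y,x))$. A transitivity path of $I$ between $c>a$ is a list $c=b_1>b_2>\dots>b_k=a$, $k\ge2$, with $\#_I(b_i,b_{i+1})>0$ for $1\le i<k$. The transitive closure $I^{\mathsf{tc}}$ is defined by letting $\#_{I^{\mathsf{tc}}}(c,a)$ be the maximal value of $\#_I(b_1,b_2)$ over all transitivity paths of $I$ between $c$ and $a$ ($0$ if there is none). *)

theory Defs
  imports "HOL-Library.Multiset" "HOL-Algebra.Lattice"
begin

text \<open>A weak composition \<open>s = (s(1), \<dots>, s(n))\<close> is a \<open>nat list\<close> of length \<open>n\<close>;
  its entries are numbered from 1.\<close>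

definition part :: "nat list \<Rightarrow> nat \<Rightarrow> nat" where
  "part s i = s ! (i - 1)"

datatype tree = Leaf | Node nat "tree list"

fun labels :: "tree \<Rightarrow> nat list" where
  "labels Leaf = []"
| "labels (Node y ts) = y # concat (map labels ts)"

fun subtrees :: "tree \<Rightarrow> tree set" where
  "subtrees Leaf = {Leaf}"
| "subtrees (Node y ts) = insert (Node y ts) (\<Union>t\<in>set ts. subtrees t)"

definition decreasing_trees :: "nat list \<Rightarrow> tree set" where
  "decreasing_trees s = {T. distinct (labels T) \<and> set (labels T) = {1..length s} \<and>
     (\<forall>y ts. Node y ts \<in> subtrees T \<longrightarrow>
        length ts = part s y + 1 \<and> (\<forall>t\<in>set ts. \<forall>x\<in>set (labels t). x < y))}"

text \<open>\<open>in_child T y i x\<close> is \<open>x \<in> T\<^sup>y\<^sub>i\<close>, with children numbered from 0.\<close>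

definition in_child :: "tree \<Rightarrow> nat \<Rightarrow> nat \<Rightarrow> nat \<Rightarrow> bool" where
  "in_child T y i x \<longleftrightarrow>
     (\<exists>ts. Node y ts \<in> subtrees T \<and> i < length ts \<and> x \<in> set (labels (ts ! i)))"

definition descendant :: "tree \<Rightarrow> nat \<Rightarrow> nat \<Rightarrow> bool" where
  "descendant T y x \<longleftrightarrow> (\<exists>i. in_child T y i x)"

text \<open>Only proper ancestors are considered: below, neither of the two nodes is a descendant
  of the other.\<close>

definition closest_common_ancestor :: "tree \<Rightarrow> nat \<Rightarrow> nat \<Rightarrow> nat \<Rightarrow> bool" where
  "closest_common_ancestor T x y z \<longleftrightarrow> descendant T z x \<and> descendant T z y \<and>
     (\<forall>w. descendant T w x \<and> descendant T w y \<longrightarrow> w = z \<or> descendant T w z)"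

definition left_of :: "tree \<Rightarrow> nat \<Rightarrow> nat \<Rightarrow> bool" where
  "left_of T x y \<longleftrightarrow> \<not> descendant T y x \<and>
     (\<exists>z i j. closest_common_ancestor T x y z \<and> in_child T z j x \<and> in_child T z i y \<and> j < i)"

definition right_of :: "tree \<Rightarrow> nat \<Rightarrow> nat \<Rightarrow> bool" where
  "right_of T x y \<longleftrightarrow> \<not> descendant T y x \<and>
     (\<exists>z i j. closest_common_ancestor T x y z \<and> in_child T z j x \<and> in_child T z i y \<and> j > i)"

text \<open>The cardinality \<open>#\<^sub>T(y,x)\<close>, meant for \<open>1 \<le> x < y \<le> n\<close> and \<open>T\<close> an
  \<open>s\<close>-decreasing tree; the final \<open>else\<close> branch does not occur then.\<close>

definition cardinality :: "nat list \<Rightarrow> tree \<Rightarrow> nat \<Rightarrow> nat \<Rightarrow> nat" where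
  "cardinality s T y x =
     (if left_of T x y then 0
      else if descendant T y x then (THE i. in_child T y i x)
      else if right_of T x y then part s y
      else 0)"

definition pairs :: "nat list \<Rightarrow> (nat \<times> nat) set" where
  "pairs s = {(y, x). 1 \<le> x \<and> x < y \<and> y \<le> length s}"

definition tree_inversions :: "nat list \<Rightarrow> tree \<Rightarrow> (nat \<times> nat) multiset" where
  "tree_inversions s T = (\<Sum>(y, x)\<in>pairs s. replicate_mset (cardinality s T y x) (y, x))"

definition weak_order :: "nat list \<Rightarrow> tree gorder" where
  "weak_order s = \<lparr>carrier = decreasing_trees s, eq = (=),
     le = (\<lambda>R T. \<forall>(y, x)\<in>pairs s. cardinality s R y x \<le> cardinality s T y x)\<rparr>"

definition transitivity_path :: "(nat \<times> nat) multiset \<Rightarrow> nat \<Rightarrow> nat \<Rightarrow> nat list \<Rightarrow> bool" where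
  "transitivity_path I c a bs \<longleftrightarrow> length bs \<ge> 2 \<and> hd bs = c \<and> last bs = a \<and>
     successively (\<lambda>b b'. b > b' \<and> count I (b, b') > 0) bs"

definition tc_mult :: "(nat \<times> nat) multiset \<Rightarrow> nat \<Rightarrow> nat \<Rightarrow> nat" where
  "tc_mult I c a =
     Max (insert 0 {count I (bs ! 0, bs ! 1) | bs. transitivity_path I c a bs})"

definition tc :: "(nat \<times> nat) multiset \<Rightarrow> (nat \<times> nat) multiset" where
  "tc I = Abs_multiset (\<lambda>(c, a). tc_mult I c a)"

text \<open>The multisets above have the intended multiplicities.\<close>

lemma finite_pairs: "finite (pairs s)"
  by (rule finite_subset[of _ "{..length s} \<times> {..length s}"]) (auto simp: pairs_def)

lemma count_tree_inversions:
  "count (tree_inversions s T) (y, x) = (if (y, x) \<in> pairs s then cardinality s T y x else 0)"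
proof -
  have "count (tree_inversions s T) (y, x) =
      (\<Sum>p\<in>pairs s. if p = (y, x) then cardinality s T y x else 0)"
    unfolding tree_inversions_def count_sum by (intro sum.cong) (auto split: prod.splits)
  then show ?thesis using finite_pairs by (simp add: sum.delta)
qed

lemma transitivity_path_endpoints:
  assumes "transitivity_path I c a bs"
  shows "c \<in> fst ` set_mset I" "a \<in> snd ` set_mset I"
proof -
  obtain b b' bs' where bs: "bs = b # b' # bs'"
    using assms by (auto simp: transitivity_path_def numeral_2_eq_2 Suc_le_length_iff)
  have succ: "successively (\<lambda>b b'. b > b' \<and> count I (b, b') > 0) bs"
    using assms by (simp add: transitivity_path_def)
  have "(c, b') \<in># I" using assms bs by (auto simp: transitivity_path_def)
  then show "c \<in> fst ` set_mset I" by force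
  have "successively (\<lambda>b b'. count I (b, b') > 0) xs \<Longrightarrow> length xs \<ge> 2 \<Longrightarrow>
      last xs \<in> snd ` set_mset I" for xs
    by (induction xs rule: induct_list012) (force simp: Suc_le_eq split: list.splits)+
  moreover have "successively (\<lambda>b b'. count I (b, b') > 0) bs"
    using succ by (rule successively_mono) auto
  ultimately show "a \<in> snd ` set_mset I"
    using assms by (auto simp: transitivity_path_def)
qed

lemma count_tc: "count (tc I) (c, a) = tc_mult I c a"
proof -
  have "{p. 0 < (case p of (c, a) \<Rightarrow> tc_mult I c a)} \<subseteq> fst ` set_mset I \<times> snd ` set_mset I"
  proof clarify
    fix c a assume "0 < tc_mult I c a"
    have "\<exists>bs. transitivity_path I c a bs"
    proof (rule ccontr)
      assume "\<nexists>bs. transitivity_path I c a bs"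
      then have "tc_mult I c a = 0" by (simp add: tc_mult_def)
      with \<open>0 < tc_mult I c a\<close> show False by simp
    qed
    then obtain bs where "transitivity_path I c a bs" by blast
    from transitivity_path_endpoints[OF this]
    show "c \<in> fst ` set_mset I \<and> a \<in> snd ` set_mset I" by blast
  qed
  then have "finite {p. 0 < (case p of (c, a) \<Rightarrow> tc_mult I c a)}"
    by (rule finite_subset) simp
  then show ?thesis by (simp add: tc_def)
qed

lemma finite_tc_values:
  "finite {count I (bs ! 0, bs ! 1) | bs. transitivity_path I c a bs}"
  by (rule finite_subset[of _ "{..size I}"]) (auto simp: count_le_size)

end

theory Submission imports Defs
begin

text \<open>A decreasing tree is determined by its multiplicities \<open>f y x\<close>: the values at the maximal
  label tell in which child subtree the other labels lie, and one recurses. The functions arising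
  this way are the bounded ones that are transitive (\<open>f b a = 0\<close> or \<open>f c b \<le> f c a\<close>) and planar
  (\<open>f b a = s b\<close> or \<open>f c a \<le> f c b\<close>) for \<open>a < b < c\<close>. The closure of a union of
  two of them is bounded and transitive, and below every other one above both. For planarity,
  take a path from \<open>c\<close> to \<open>a\<close> and its step over \<open>b\<close>: planarity of the step either lets the path
  go through \<open>b\<close>, or gives a path from \<open>b\<close> to \<open>a\<close> whose first multiplicity is \<open>s b\<close>. Finitely
  many trees, joins and a bottom element give meets.\<close>

section \<open>Trees and their subtrees\<close>

text \<open>The condition on the label set is left out because the inductions pass to children,
  whose labels need not form an interval starting at 1.\<close>

definition s_decreasing :: "nat list \<Rightarrow> tree \<Rightarrow> bool" where
  "s_decreasing s T \<longleftrightarrow> distinct (labels T) \<and>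
     (\<forall>y ts. Node y ts \<in> subtrees T \<longrightarrow>
        length ts = part s y + 1 \<and> (\<forall>t\<in>set ts. \<forall>x\<in>set (labels t). x < y))"

lemma decreasing_trees_iff:
  "T \<in> decreasing_trees s \<longleftrightarrow> s_decreasing s T \<and> set (labels T) = {1..length s}"
  by (auto simp: decreasing_trees_def s_decreasing_def)

lemma s_decreasing_Leaf: "s_decreasing s Leaf"
  by (simp add: s_decreasing_def)

lemma label_of_subtree: "Node y ts \<in> subtrees T \<Longrightarrow> y \<in> set (labels T)"
  by (induction T) auto

lemma labels_subtree: "t \<in> subtrees T \<Longrightarrow> set (labels t) \<subseteq> set (labels T)"
  by (induction T) auto

lemma in_child_labels:
  assumes "in_child T y i x"
  shows "y \<in> set (labels T)" "x \<in> set (labels T)"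
proof -
  obtain ts where ts: "Node y ts \<in> subtrees T" "i < length ts" "x \<in> set (labels (ts ! i))"
    using assms by (auto simp: in_child_def)
  show "y \<in> set (labels T)" using ts(1) by (rule label_of_subtree)
  have "x \<in> set (labels (Node y ts))" using ts(2,3) by force
  then show "x \<in> set (labels T)" using labels_subtree[OF ts(1)] by blast
qed

lemma descendant_labels:
  assumes "descendant T y x"
  shows "y \<in> set (labels T)" "x \<in> set (labels T)"
  using assms in_child_labels by (auto simp: descendant_def)

text \<open>Disjointness compares positions and not lists: several children may be leaves and then
  share the empty list of labels.\<close>

lemma distinct_concat_nth_iff:
  "distinct (concat xss) \<longleftrightarrow> (\<forall>i<length xss. distinct (xss ! i)) \<and>
     (\<forall>i<length xss. \<forall>j<length xss. i \<noteq> j \<longrightarrow> set (xss ! i) \<inter> set (xss ! j) = {})"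
proof (induction xss)
  case (Cons xs xss)
  have all_Suc: "(\<forall>i<Suc n. P i) \<longleftrightarrow> P 0 \<and> (\<forall>i<n. P (Suc i))" for n P
    by (auto simp: less_Suc_eq_0_disj)
  have "set xs \<inter> set (concat xss) = {} \<longleftrightarrow> (\<forall>i<length xss. set xs \<inter> set (xss ! i) = {})"
    by (fastforce simp: in_set_conv_nth[of _ xss])
  then have "distinct (concat (xs # xss)) \<longleftrightarrow> distinct xs \<and> distinct (concat xss) \<and>
      (\<forall>i<length xss. set xs \<inter> set (xss ! i) = {})"
    by simp
  then show ?case
    unfolding Cons.IH length_Cons all_Suc nth_Cons_0 nth_Cons_Suc
    by (simp only: Suc_not_Zero Zero_not_Suc Suc_inject) blast
qed simp

lemma s_decreasing_Node_iff:
  "s_decreasing s (Node m ts) \<longleftrightarrow> length ts = part s m + 1 \<and>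
     (\<forall>k<length ts. s_decreasing s (ts ! k) \<and> (\<forall>x\<in>set (labels (ts ! k)). x < m)) \<and>
     (\<forall>i<length ts. \<forall>j<length ts. i \<noteq> j \<longrightarrow> set (labels (ts ! i)) \<inter> set (labels (ts ! j)) = {})"
proof -
  define Q where "Q y us \<longleftrightarrow> length us = part s y + 1 \<and> (\<forall>t\<in>set us. \<forall>x\<in>set (labels t). x < y)" for y us
  have all_set: "(\<forall>t\<in>set ts. P t) \<longleftrightarrow> (\<forall>k<length ts. P (ts ! k))" for P
    by (metis in_set_conv_nth)
  have "(\<forall>y us. Node y us \<in> subtrees (Node m ts) \<longrightarrow> Q y us) \<longleftrightarrow>
      Q m ts \<and> (\<forall>t\<in>set ts. \<forall>y us. Node y us \<in> subtrees t \<longrightarrow> Q y us)"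
    by auto
  \<comment> \<open>The root label exceeds everything below it, so distinctness of all labels
    reduces to distinctness within and between the children.\<close>
  moreover have "m \<notin> set (labels t)" if "t \<in> set ts" "Q m ts" for t
    using that unfolding Q_def by blast
  then have "distinct (labels (Node m ts)) \<longleftrightarrow> distinct (concat (map labels ts))" if "Q m ts"
    using that by auto
  moreover have "distinct (concat (map labels ts)) \<longleftrightarrow> (\<forall>t\<in>set ts. distinct (labels t)) \<and>
     (\<forall>i<length ts. \<forall>j<length ts. i \<noteq> j \<longrightarrow> set (labels (ts ! i)) \<inter> set (labels (ts ! j)) = {})"
    unfolding all_set distinct_concat_nth_iff by simp
  ultimately have "s_decreasing s (Node m ts) \<longleftrightarrow> Q m ts \<and> (\<forall>t\<in>set ts. s_decreasing s t) \<and>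
     (\<forall>i<length ts. \<forall>j<length ts. i \<noteq> j \<longrightarrow> set (labels (ts ! i)) \<inter> set (labels (ts ! j)) = {})"
    unfolding s_decreasing_def Q_def[symmetric] by blast
  then show ?thesis unfolding Q_def all_set by blast
qed

section \<open>Ancestry and cardinalities in a tree compared with its children\<close>

locale s_decreasing_node =
  fixes s m ts
  assumes node: "s_decreasing s (Node m ts)"
begin

lemma length_children: "length ts = part s m + 1"
  and child_less: "k < length ts \<Longrightarrow> x \<in> set (labels (ts ! k)) \<Longrightarrow> x < m"
  and child_s_decreasing: "k < length ts \<Longrightarrow> s_decreasing s (ts ! k)"
  and child_unique: "\<lbrakk>x \<in> set (labels (ts ! i)); x \<in> set (labels (ts ! j));
    i < length ts; j < length ts\<rbrakk> \<Longrightarrow> i = j"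
  using node unfolding s_decreasing_Node_iff by blast+

lemma root_not_in_child: "k < length ts \<Longrightarrow> m \<notin> set (labels (ts ! k))"
  using child_less by blast

lemma set_labels: "set (labels (Node m ts)) = insert m (\<Union>k<length ts. set (labels (ts ! k)))"
  by (auto simp: in_set_conv_nth[of _ ts]) (metis nth_mem)

lemma in_child_root: "in_child (Node m ts) m i x \<longleftrightarrow> i < length ts \<and> x \<in> set (labels (ts ! i))"
proof -
  have "ts' = ts" if "Node m ts' \<in> subtrees (Node m ts)" for ts'
    using that label_of_subtree[of m ts'] root_not_in_child by (fastforce simp: in_set_conv_nth[of _ ts])
  then show ?thesis by (auto simp: in_child_def)
qed

text \<open>As \<open>y < m\<close> and the children share no label, every subtree with top label
  \<open>y\<close> lies inside child \<open>k\<close>.\<close>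

lemma in_child_child:
  assumes k: "k < length ts" and y: "y \<in> set (labels (ts ! k))"
  shows "in_child (Node m ts) y i x \<longleftrightarrow> in_child (ts ! k) y i x"
proof -
  have "Node y us \<in> subtrees (Node m ts) \<longleftrightarrow> Node y us \<in> subtrees (ts ! k)" for us
  proof
    assume "Node y us \<in> subtrees (Node m ts)"
    then obtain t where "t \<in> set ts" "Node y us \<in> subtrees t" using child_less[OF k y] by auto
    then show "Node y us \<in> subtrees (ts ! k)"
      using label_of_subtree child_unique[OF y _ k] by (metis in_set_conv_nth)
  qed (use k in auto)
  then show ?thesis by (simp add: in_child_def)
qed

lemma descendant_root: "descendant (Node m ts) m x \<longleftrightarrow> (\<exists>k<length ts. x \<in> set (labels (ts ! k)))"
  by (auto simp: descendant_def in_child_root)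

lemma descendant_child:
  "k < length ts \<Longrightarrow> y \<in> set (labels (ts ! k)) \<Longrightarrow>
    descendant (Node m ts) y x \<longleftrightarrow> descendant (ts ! k) y x"
  by (simp add: descendant_def in_child_child)

lemma descendant_cases:
  assumes "descendant (Node m ts) z x"
  obtains "z = m" | k where "k < length ts" "z \<in> set (labels (ts ! k))"
    "x \<in> set (labels (ts ! k))" "descendant (ts ! k) z x"
  using assms descendant_labels[OF assms] descendant_labels[of "ts ! _" z x]
  unfolding set_labels by (auto simp: descendant_child)

text \<open>Passing from the child to the whole tree adds \<open>m\<close> as a common ancestor. It
  can even become the closest one, namely when \<open>x\<close> or \<open>y\<close> is the top label
  of the child. The condition \<open>i \<noteq> j\<close> excludes it, since both nodes lie in the
  same child of \<open>m\<close>; this is why the equivalence includes the two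
  \<open>in_child\<close> conditions.\<close>

lemma closest_common_ancestor_child:
  assumes k: "k < length ts" and x: "x \<in> set (labels (ts ! k))" and y: "y \<in> set (labels (ts ! k))"
    and ne: "i \<noteq> j"
  shows "closest_common_ancestor (Node m ts) x y z \<and> in_child (Node m ts) z j x \<and>
      in_child (Node m ts) z i y \<longleftrightarrow>
    closest_common_ancestor (ts ! k) x y z \<and> in_child (ts ! k) z j x \<and> in_child (ts ! k) z i y"
    (is "?L \<longleftrightarrow> ?R")
proof
  assume ?L
  then have L: "closest_common_ancestor (Node m ts) x y z" "in_child (Node m ts) z j x"
     "in_child (Node m ts) z i y" by auto
  have "z \<noteq> m" using L(2,3) ne x y k child_unique by (metis in_child_root)
  then have z: "z \<in> set (labels (ts ! k))"
    using L(2) child_unique[OF x _ k] descendant_cases[of z x] by (metis descendant_def)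
  have "w = z \<or> descendant (ts ! k) w z"
    if "descendant (ts ! k) w x" "descendant (ts ! k) w y" for w
    using that L(1) descendant_labels[OF that(1)] descendant_child[OF k]
    unfolding closest_common_ancestor_def by blast
  then show ?R
    using L z by (auto simp: closest_common_ancestor_def in_child_child[OF k] descendant_child[OF k])
next
  assume ?R
  then have R: "closest_common_ancestor (ts ! k) x y z" "in_child (ts ! k) z j x"
     "in_child (ts ! k) z i y" by auto
  have z: "z \<in> set (labels (ts ! k))" using R(2) in_child_labels by blast
  have "w = z \<or> descendant (Node m ts) w z"
    if wx: "descendant (Node m ts) w x" and wy: "descendant (Node m ts) w y" for w
  proof (cases "w = m")
    case True
    then show ?thesis using z k descendant_root by blast
  next
    case False
    then have w: "w \<in> set (labels (ts ! k))"
      using child_unique[OF x _ k] descendant_cases[OF wx] by metis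
    then show ?thesis using R(1) wx wy descendant_child[OF k w]
      unfolding closest_common_ancestor_def by blast
  qed
  then show ?L
    using R z by (auto simp: closest_common_ancestor_def in_child_child[OF k] descendant_child[OF k])
qed

lemma cardinality_same_child:
  assumes k: "k < length ts" and x: "x \<in> set (labels (ts ! k))" and y: "y \<in> set (labels (ts ! k))"
  shows "cardinality s (Node m ts) y x = cardinality s (ts ! k) y x"
proof -
  have "left_of (Node m ts) x y \<longleftrightarrow> left_of (ts ! k) x y"
    "right_of (Node m ts) x y \<longleftrightarrow> right_of (ts ! k) x y"
    unfolding left_of_def right_of_def descendant_child[OF k y]
    by (metis closest_common_ancestor_child[OF k x y] less_irrefl)+
  then show ?thesis
    by (simp add: cardinality_def descendant_child[OF k y] in_child_child[OF k y])
qed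

lemma cardinality_root:
  assumes "i < length ts" "x \<in> set (labels (ts ! i))"
  shows "cardinality s (Node m ts) m x = i"
proof -
  have "descendant (Node m ts) m x" using assms descendant_root by blast
  moreover have "(THE i. in_child (Node m ts) m i x) = i"
    using assms child_unique by (intro the_equality) (auto simp: in_child_root)
  ultimately show ?thesis by (simp add: cardinality_def left_of_def)
qed

text \<open>The root is the only common ancestor of nodes in different children, so the order of
  these two children decides between left and right.\<close>

lemma cardinality_distinct_children:
  assumes j: "j < length ts" "x \<in> set (labels (ts ! j))"
    and i: "i < length ts" "y \<in> set (labels (ts ! i))" and ne: "i \<noteq> j"
  shows "cardinality s (Node m ts) y x = (if j < i then 0 else part s y)"
proof -
  have nd: "\<not> descendant (Node m ts) y x"
    using assms child_unique child_less descendant_cases[of y x] by (metis less_irrefl)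
  have common: "w = m" if "descendant (Node m ts) w x" "descendant (Node m ts) w y" for w
    using that descendant_cases[of w x] descendant_cases[of w y] assms child_unique by metis
  then have cca: "closest_common_ancestor (Node m ts) x y z \<longleftrightarrow> z = m" for z
    using assms unfolding closest_common_ancestor_def by (metis descendant_root)
  have "in_child (Node m ts) m j' x \<longleftrightarrow> j' = j" "in_child (Node m ts) m i' y \<longleftrightarrow> i' = i" for i' j'
    using assms child_unique by (auto simp: in_child_root)
  then have "left_of (Node m ts) x y \<longleftrightarrow> j < i" "right_of (Node m ts) x y \<longleftrightarrow> i < j"
    using nd by (auto simp: left_of_def right_of_def cca)
  then show ?thesis using nd ne by (auto simp: cardinality_def)
qed

end

section \<open>Multiplicity functions of trees\<close>

text \<open>For fixed \<open>c\<close>, read \<open>f c\<close> as a position from left to right.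
  Transitivity: if \<open>a\<close> is not at the far left of \<open>b\<close>, then
  \<open>c\<close> sees \<open>a\<close> no further left than \<open>b\<close>. Planarity is the
  mirror image: if \<open>a\<close> is not at the far right of \<open>b\<close>, then
  \<open>c\<close> sees \<open>a\<close> no further right than \<open>b\<close>. The set
  \<open>A\<close> is arbitrary so that one can restrict to the labels of a child.\<close>

definition tree_like :: "nat list \<Rightarrow> nat set \<Rightarrow> (nat \<Rightarrow> nat \<Rightarrow> nat) \<Rightarrow> bool" where
  "tree_like s A f \<longleftrightarrow>
     (\<forall>a\<in>A. \<forall>b\<in>A. a < b \<longrightarrow> f b a \<le> part s b) \<and>
     (\<forall>a\<in>A. \<forall>b\<in>A. \<forall>c\<in>A. a < b \<longrightarrow> b < c \<longrightarrow>
        (f b a = 0 \<or> f c b \<le> f c a) \<and> (f b a = part s b \<or> f c a \<le> f c b))"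

lemma tree_like_bound: "tree_like s A f \<Longrightarrow> a \<in> A \<Longrightarrow> b \<in> A \<Longrightarrow> a < b \<Longrightarrow> f b a \<le> part s b"
  by (simp add: tree_like_def)

lemma tree_like_transitive:
  "\<lbrakk>tree_like s A f; a \<in> A; b \<in> A; c \<in> A; a < b; b < c; 0 < f b a\<rbrakk> \<Longrightarrow> f c b \<le> f c a"
  by (fastforce simp: tree_like_def)

lemma tree_like_planar:
  "\<lbrakk>tree_like s A f; a \<in> A; b \<in> A; c \<in> A; a < b; b < c\<rbrakk> \<Longrightarrow> f b a = part s b \<or> f c a \<le> f c b"
  by (fastforce simp: tree_like_def)

lemma tree_like_subset: "tree_like s A f \<Longrightarrow> B \<subseteq> A \<Longrightarrow> tree_like s B f"
  unfolding tree_like_def by (meson subsetD)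

text \<open>Structural induction. For a triple \<open>a < b < c\<close> either \<open>c\<close> is
  the root and its values are child numbers, or all three lie in one child, or the root separates
  \<open>c\<close> from \<open>a\<close> or \<open>b\<close>.\<close>

lemma tree_like_cardinality:
  assumes "s_decreasing s T"
  shows "tree_like s (set (labels T)) (cardinality s T)"
  using assms
proof (induction T)
  case Leaf
  then show ?case by (simp add: tree_like_def)
next
  case (Node m ts)
  interpret s_decreasing_node s m ts by unfold_locales (rule Node.prems)
  let ?f = "cardinality s (Node m ts)"
  have pos: "(x = m) \<noteq> (\<exists>k<length ts. x \<in> set (labels (ts ! k)))"
    if "x \<in> set (labels (Node m ts))" for x
    using that root_not_in_child unfolding set_labels by blast
  have IH: "tree_like s (set (labels (ts ! k))) ?f" if "k < length ts" for k
    using Node.IH[OF nth_mem[OF that] child_s_decreasing[OF that]]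
    unfolding tree_like_def by (simp add: cardinality_same_child[OF that])
  have le: "x \<le> m" if "x \<in> set (labels (Node m ts))" for x
    using that child_less unfolding set_labels by fastforce
  have child: "\<exists>k<length ts. x \<in> set (labels (ts ! k))"
    if "x \<in> set (labels (Node m ts))" "y \<in> set (labels (Node m ts))" "x < y" for x y
    using pos[OF that(1)] le[OF that(2)] that(3) by auto
  have bound: "?f b a \<le> part s b"
    if a: "a \<in> set (labels (Node m ts))" and b: "b \<in> set (labels (Node m ts))" and "a < b" for a b
  proof -
    obtain k where k: "k < length ts" "a \<in> set (labels (ts ! k))" using child[OF a b \<open>a < b\<close>] by blast
    show ?thesis
    proof (cases "b = m")
      case True
      then show ?thesis using k length_children by (simp add: cardinality_root)
    next
      case False
      then obtain j where j: "j < length ts" "b \<in> set (labels (ts ! j))" using pos[OF b] by blast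
      show ?thesis
      proof (cases "j = k")
        case True
        then show ?thesis using tree_like_bound[OF IH[OF k(1)] k(2)] j \<open>a < b\<close> by blast
      next
        case False
        then show ?thesis using cardinality_distinct_children[OF k j] by auto
      qed
    qed
  qed
  have "(?f b a = 0 \<or> ?f c b \<le> ?f c a) \<and> (?f b a = part s b \<or> ?f c a \<le> ?f c b)"
    if a: "a \<in> set (labels (Node m ts))" and b: "b \<in> set (labels (Node m ts))"
      and c: "c \<in> set (labels (Node m ts))" and "a < b" "b < c" for a b c
  proof -
    obtain k where k: "k < length ts" "a \<in> set (labels (ts ! k))" using child[OF a b \<open>a < b\<close>] by blast
    obtain j where j: "j < length ts" "b \<in> set (labels (ts ! j))" using child[OF b c \<open>b < c\<close>] by blast
    show ?thesis
    proof (cases "c = m")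
      case True
      then show ?thesis
        using cardinality_distinct_children[OF k j]
        by (cases "j = k") (auto simp: cardinality_root[OF k] cardinality_root[OF j])
    next
      case False
      then obtain i where i: "i < length ts" "c \<in> set (labels (ts ! i))" using pos[OF c] by blast
      show ?thesis
      proof (cases "k = i \<and> j = i")
        case True
        then have "a \<in> set (labels (ts ! i))" "b \<in> set (labels (ts ! i))" using k j by auto
        then show ?thesis
          using IH[OF i(1)] i(2) \<open>a < b\<close> \<open>b < c\<close> unfolding tree_like_def by blast
      next
        case False
        have ba: "j \<noteq> k \<Longrightarrow> ?f b a = (if k < j then 0 else part s b)"
          and cb: "i \<noteq> j \<Longrightarrow> ?f c b = (if j < i then 0 else part s c)"
          and ca: "i \<noteq> k \<Longrightarrow> ?f c a = (if k < i then 0 else part s c)"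
          using cardinality_distinct_children k j i by blast+
        note bounds = bound[OF b c \<open>b < c\<close>] bound[OF a c order.strict_trans[OF \<open>a < b\<close> \<open>b < c\<close>]]
        show ?thesis
          \<comment> \<open>If \<open>a\<close> and \<open>b\<close> share a child, \<open>c\<close>
            is in another one and its two values agree. Otherwise \<open>?f b a\<close> is extremal
            and the order of the children gives the remaining inequality; \<open>bounds\<close>
            covers the value inside a child that \<open>c\<close> shares with \<open>a\<close> or
            \<open>b\<close>.\<close>
          using False ba cb ca bounds
          by (cases "j = k"; cases "i = j"; cases "i = k") (auto split: if_splits)
      qed
    qed
  qed
  then show ?case unfolding tree_like_def using bound by blast
qed

text \<open>The root must be the largest label, and the values there distribute the other labels
  among the children. Within a child the induction hypothesis gives the right multiplicities;
  between children they are forced by transitivity and planarity.\<close>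

lemma tree_of_tree_like:
  assumes "finite A" "tree_like s A f"
  shows "\<exists>T. s_decreasing s T \<and> set (labels T) = A \<and>
    (\<forall>x\<in>A. \<forall>y\<in>A. x < y \<longrightarrow> cardinality s T y x = f y x)"
  using assms
proof (induction A rule: finite_psubset_induct)
  case (psubset A)
  show ?case
  proof (cases "A = {}")
    case True
    then show ?thesis using s_decreasing_Leaf by (intro exI[of _ Leaf]) simp
  next
    case False
    define m where "m = Max A"
    have m: "m \<in> A" "\<And>x. x \<in> A \<Longrightarrow> x \<noteq> m \<Longrightarrow> x < m"
      unfolding m_def using Max_in[OF psubset.hyps False] Max_ge[OF psubset.hyps]
      by (blast, metis le_neq_implies_less)
    define B where "B k = {x \<in> A. x \<noteq> m \<and> f m x = k}" for k
    have "tree_like s (B k) f" for k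
      using psubset.prems by (rule tree_like_subset) (auto simp: B_def)
    moreover have "B k \<subset> A" for k unfolding B_def using m(1) by blast
    ultimately have "\<exists>T. s_decreasing s T \<and> set (labels T) = B k \<and>
      (\<forall>x\<in>B k. \<forall>y\<in>B k. x < y \<longrightarrow> cardinality s T y x = f y x)" for k
      by (intro psubset.IH)
    then obtain F where F: "\<And>k. s_decreasing s (F k)" "\<And>k. set (labels (F k)) = B k"
      "\<And>k x y. x \<in> B k \<Longrightarrow> y \<in> B k \<Longrightarrow> x < y \<Longrightarrow> cardinality s (F k) y x = f y x"
      by metis
    \<comment> \<open>By the bound on \<open>f m\<close>, the labels other than \<open>m\<close> all
      lie in the sets \<open>B k\<close> with \<open>k \<le> part s m\<close>; an empty
      \<open>B k\<close> yields a leaf.\<close>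
    define ts where "ts = map F [0..<part s m + 1]"
    have nth: "ts ! k = F k" if "k < length ts" for k using that by (simp add: ts_def del: upt_Suc)
    have len: "length ts = part s m + 1" by (simp add: ts_def)
    have dec: "s_decreasing s (Node m ts)"
      unfolding s_decreasing_Node_iff using F m(2) by (auto simp: len nth B_def)
    then interpret s_decreasing_node s m ts by unfold_locales
    have B: "x \<in> B (f m x)" "f m x < length ts" if "x \<in> A" "x \<noteq> m" for x
      using that m tree_like_bound[OF psubset.prems that(1) m(1)] by (auto simp: B_def len less_Suc_eq_le)
    have lab: "set (labels (Node m ts)) = A"
      unfolding set_labels using m B by (auto simp: nth F(2)) (auto simp: B_def)
    have "cardinality s (Node m ts) y x = f y x" if "x \<in> A" "y \<in> A" "x < y" for x y
    proof -
      have x: "x \<noteq> m" using that m(2)[of y] by auto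
      note Bx = B[OF \<open>x \<in> A\<close> x]
      have xc: "x \<in> set (labels (ts ! f m x))" using Bx by (simp add: nth F(2))
      show ?thesis
      proof (cases "y = m")
        case True
        then show ?thesis using cardinality_root[OF Bx(2) xc] by simp
      next
        case False
        note By = B[OF \<open>y \<in> A\<close> False]
        have yc: "y \<in> set (labels (ts ! f m y))" using By by (simp add: nth F(2))
        show ?thesis
        proof (cases "f m x = f m y")
          case True
          have "cardinality s (Node m ts) y x = cardinality s (ts ! f m y) y x"
            using By(2) xc yc True by (intro cardinality_same_child) auto
          also have "\<dots> = f y x" unfolding nth[OF By(2)] using Bx By True \<open>x < y\<close> by (auto intro!: F(3))
          finally show ?thesis .
        next
          case ne: False
          \<comment> \<open>Suppose \<open>f y x\<close> is positive. Transitivity then puts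
            \<open>x\<close> in a child further right than that of \<open>y\<close>, and planarity
            forces the value \<open>part s y\<close>. If \<open>f y x = 0\<close>, planarity puts
            \<open>x\<close> further left, unless \<open>part s y = 0\<close>, where both possible
            values of the cardinality coincide.\<close>
          have "y < m" using m(2) that(2) False .
          then show ?thesis
            using cardinality_distinct_children[OF Bx(2) xc By(2) yc] ne
              tree_like_transitive[OF psubset.prems that(1,2) m(1) that(3)]
              tree_like_planar[OF psubset.prems that(1,2) m(1) that(3)]
            by (cases "f y x = 0") auto
        qed
      qed
    qed
    then show ?thesis using dec lab by blast
  qed
qed

text \<open>Both roots are the largest label. The cardinalities there tell which child contains a
  given label, so corresponding children have equal label sets and the induction applies to
  them.\<close>

lemma cardinality_inject:
  assumes "s_decreasing s T" "s_decreasing s R" "set (labels T) = set (labels R)"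
    and "\<And>x y. x \<in> set (labels T) \<Longrightarrow> y \<in> set (labels T) \<Longrightarrow> x < y \<Longrightarrow>
      cardinality s T y x = cardinality s R y x"
  shows "T = R"
  using assms
proof (induction T arbitrary: R)
  case Leaf
  show ?case using Leaf.prems(3) by (cases R) simp_all
next
  case (Node m ts)
  have "R \<noteq> Leaf" using Node.prems(3) by auto
  then obtain m' us where R: "R = Node m' us" by (cases R) simp_all
  interpret T: s_decreasing_node s m ts by (rule s_decreasing_node.intro) (rule Node.prems(1))
  interpret R: s_decreasing_node s m' us
    by (rule s_decreasing_node.intro) (rule Node.prems(2)[unfolded R])
  have labs: "insert m (\<Union>k<length ts. set (labels (ts ! k))) =
      insert m' (\<Union>k<length us. set (labels (us ! k)))"
    using Node.prems(3) unfolding R T.set_labels R.set_labels .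
  have m: "m' = m"
  proof (rule antisym)
    have "m \<in> insert m' (\<Union>k<length us. set (labels (us ! k)))" unfolding labs[symmetric] by blast
    then show "m \<le> m'" using R.child_less less_imp_le by blast
    have "m' \<in> insert m (\<Union>k<length ts. set (labels (ts ! k)))" unfolding labs by blast
    then show "m' \<le> m" using T.child_less less_imp_le by blast
  qed
  have children: "(\<Union>k<length ts. set (labels (ts ! k))) = (\<Union>k<length us. set (labels (us ! k)))"
  proof (rule insert_ident[THEN iffD1, OF _ _ labs[unfolded m]])
    show "m \<notin> (\<Union>k<length ts. set (labels (ts ! k)))" using T.root_not_in_child by blast
    show "m \<notin> (\<Union>k<length us. set (labels (us ! k)))" using R.root_not_in_child m by blast
  qed
  have len: "length us = length ts" using T.length_children R.length_children m by simp
  have card: "cardinality s (Node m ts) y x = cardinality s (Node m us) y x"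
    if "x \<in> set (labels (Node m ts))" "y \<in> set (labels (Node m ts))" "x < y" for x y
    using Node.prems(4)[OF that] unfolding R m .
  have sub1: "x \<in> set (labels (us ! k))" if k: "k < length ts" and x: "x \<in> set (labels (ts ! k))" for k x
  proof -
    have xm: "x < m" using T.child_less k x by blast
    then obtain j where j: "j < length us" "x \<in> set (labels (us ! j))" using children k x by blast
    have "x \<in> set (labels (Node m ts))" "m \<in> set (labels (Node m ts))"
      unfolding T.set_labels using k x by auto
    from card[OF this xm] have "k = j"
      using T.cardinality_root[OF k x] R.cardinality_root[OF j] m by simp
    then show ?thesis using j by simp
  qed
  \<comment> \<open>The reverse inclusion follows from \<open>sub1\<close>: the child of the first
    tree containing \<open>x\<close> has its labels in the child of \<open>R\<close> with the same
    number, and the children of \<open>R\<close> are disjoint.\<close>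
  have sub2: "x \<in> set (labels (ts ! k))" if k: "k < length ts" and x: "x \<in> set (labels (us ! k))" for k x
  proof -
    obtain j where j: "j < length ts" "x \<in> set (labels (ts ! j))"
      using children k[folded len] x by blast
    have "x \<in> set (labels (us ! j))" using sub1 j by blast
    then have "j = k" using R.child_unique x k j len by auto
    then show ?thesis using j by simp
  qed
  have "ts ! k = us ! k" if k: "k < length ts" for k
  proof (rule Node.IH[OF nth_mem[OF k]])
    show "s_decreasing s (ts ! k)" using T.child_s_decreasing k .
    show "s_decreasing s (us ! k)" using R.child_s_decreasing k len by simp
    show eq: "set (labels (ts ! k)) = set (labels (us ! k))" using sub1 sub2 k by blast
    fix x y assume xy: "x \<in> set (labels (ts ! k))" "y \<in> set (labels (ts ! k))" "x < y"
    then have "x \<in> set (labels (Node m ts))" "y \<in> set (labels (Node m ts))"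
      unfolding T.set_labels using k by auto
    from card[OF this \<open>x < y\<close>] show "cardinality s (ts ! k) y x = cardinality s (us ! k) y x"
      using T.cardinality_same_child[OF k xy(1,2)] R.cardinality_same_child[of k x y] xy eq k len m
      by simp
  qed
  then have "ts = us" using len by (intro nth_equalityI) auto
  then show ?case using R m by simp
qed

section \<open>Transitive closure\<close>

definition inversion_step :: "(nat \<times> nat) multiset \<Rightarrow> nat \<Rightarrow> nat \<Rightarrow> bool" where
  "inversion_step I b b' \<longleftrightarrow> b' < b \<and> 0 < count I (b, b')"

lemma rtranclp_successively:
  "R\<^sup>*\<^sup>* d a \<longleftrightarrow> (\<exists>xs. xs \<noteq> [] \<and> hd xs = d \<and> last xs = a \<and> successively R xs)"
proof
  assume "R\<^sup>*\<^sup>* d a"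
  then show "\<exists>xs. xs \<noteq> [] \<and> hd xs = d \<and> last xs = a \<and> successively R xs"
  proof (induction rule: converse_rtranclp_induct)
    case base
    show ?case by (intro exI[of _ "[a]"]) simp
  next
    case (step y z)
    then obtain xs where "xs \<noteq> []" "hd xs = z" "last xs = a" "successively R xs" by blast
    then show ?case using step.hyps(1) by (intro exI[of _ "y # xs"]) (simp add: successively_Cons)
  qed
next
  assume "\<exists>xs. xs \<noteq> [] \<and> hd xs = d \<and> last xs = a \<and> successively R xs"
  then obtain xs where "xs \<noteq> []" "hd xs = d" "last xs = a" "successively R xs" by blast
  then show "R\<^sup>*\<^sup>* d a"
  proof (induction xs arbitrary: d)
    case (Cons x xs)
    show ?case
    proof (cases "xs = []")
      case True
      then show ?thesis using Cons.prems by simp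
    next
      case False
      then have "R d (hd xs)" "successively R xs" "last xs = a"
        using Cons.prems by (auto simp: successively_Cons)
      then show ?thesis using Cons.IH[OF False] by (meson converse_rtranclp_into_rtranclp)
    qed
  qed simp
qed

text \<open>Separates the first step, whose multiplicity is the value of the path; the rest of the
  path matters only through reachability.\<close>

lemma transitivity_path_iff:
  "transitivity_path I c a bs \<longleftrightarrow> (\<exists>xs. bs = c # xs \<and> xs \<noteq> [] \<and> last xs = a \<and>
     inversion_step I c (hd xs) \<and> successively (inversion_step I) xs)"
proof -
  have eq: "(\<lambda>b b'. b > b' \<and> count I (b, b') > 0) = inversion_step I"
    by (auto simp: fun_eq_iff inversion_step_def)
  show ?thesis
    unfolding transitivity_path_def eq by (cases bs) (auto simp: successively_Cons Suc_le_eq)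
qed

text \<open>Replaces the maximum by the existence of a path. The default 0 in the maximum belongs to
  no path, hence \<open>0 < k\<close>; this also makes the first move from \<open>c\<close> to
  \<open>d\<close> a genuine inversion step.\<close>

lemma le_tc_mult_iff:
  assumes "0 < k"
  shows "k \<le> tc_mult I c a \<longleftrightarrow> (\<exists>d<c. k \<le> count I (c, d) \<and> (inversion_step I)\<^sup>*\<^sup>* d a)"
proof -
  have "k \<le> tc_mult I c a \<longleftrightarrow> (\<exists>bs. transitivity_path I c a bs \<and> k \<le> count I (bs ! 0, bs ! 1))"
    using assms finite_tc_values unfolding tc_mult_def by (subst Max_ge_iff) auto
  also have "\<dots> \<longleftrightarrow> (\<exists>xs. xs \<noteq> [] \<and> last xs = a \<and> inversion_step I c (hd xs) \<and>
      successively (inversion_step I) xs \<and> k \<le> count I (c, hd xs))"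
    unfolding transitivity_path_iff by (auto simp: hd_conv_nth)
  also have "\<dots> \<longleftrightarrow> (\<exists>d<c. k \<le> count I (c, d) \<and> (inversion_step I)\<^sup>*\<^sup>* d a)"
    unfolding rtranclp_successively inversion_step_def using assms order.strict_trans2 by blast
  finally show ?thesis .
qed

lemma inversion_step_rtranclp_le: "(inversion_step I)\<^sup>*\<^sup>* d a \<Longrightarrow> a \<le> d"
  by (induction rule: rtranclp_induct) (auto simp: inversion_step_def)

lemma inversion_step_rtranclp_in:
  assumes "(inversion_step I)\<^sup>*\<^sup>* d a" "d \<in> A" "\<And>y x. 0 < count I (y, x) \<Longrightarrow> x \<in> A"
  shows "a \<in> A"
  using assms(1,2) by (induction rule: rtranclp_induct) (use assms(3) in \<open>auto simp: inversion_step_def\<close>)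

section \<open>Closure of the union of two multiplicity functions\<close>

locale join_inversions =
  fixes s :: "nat list" and A :: "nat set" and f g :: "nat \<Rightarrow> nat \<Rightarrow> nat"
    and I :: "(nat \<times> nat) multiset"
  assumes f: "tree_like s A f" and g: "tree_like s A g"
    and count: "\<And>y x. count I (y, x) = (if x \<in> A \<and> y \<in> A \<and> x < y then max (f y x) (g y x) else 0)"
begin

lemma in_A: "0 < count I (y, x) \<Longrightarrow> x \<in> A \<and> y \<in> A \<and> x < y"
  by (metis count less_irrefl)

lemma count_bound: "count I (y, x) \<le> part s y"
  unfolding count using tree_like_bound[OF f] tree_like_bound[OF g] by simp

text \<open>Planarity survives the pointwise maximum: if one function reaches the bound
  \<open>part s b\<close>, so does the maximum, and otherwise both inequalities hold. Transitivity
  can fail for the maximum, which is what the closure repairs.\<close>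

lemma count_planar:
  assumes "a < b" "b < c" "b \<in> A"
  shows "count I (b, a) = part s b \<or> count I (c, a) \<le> count I (c, b)"
proof (cases "a \<in> A \<and> c \<in> A")
  case True
  then have "f b a = part s b \<or> f c a \<le> f c b" "g b a = part s b \<or> g c a \<le> g c b"
    using assms tree_like_planar[OF f] tree_like_planar[OF g] by blast+
  moreover have "f b a \<le> part s b" "g b a \<le> part s b"
    using True assms tree_like_bound[OF f] tree_like_bound[OF g] by blast+
  moreover have "count I (b, a) = max (f b a) (g b a)" "count I (c, a) = max (f c a) (g c a)"
    "count I (c, b) = max (f c b) (g c b)"
    using True assms by (simp_all add: count)
  ultimately show ?thesis by linarith
next
  case False
  then show ?thesis by (auto simp: count)
qed

lemma tc_mult_bound: "tc_mult I c a \<le> part s c"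
proof (cases "tc_mult I c a = 0")
  case False
  then show ?thesis using le_tc_mult_iff[of "tc_mult I c a" I c a] count_bound le_trans by blast
qed simp

text \<open>Appending a path from \<open>b\<close> to \<open>a\<close> to a path from
  \<open>c\<close> to \<open>b\<close> leaves the first step unchanged.\<close>

lemma tc_mult_transitive:
  assumes "0 < tc_mult I b a"
  shows "tc_mult I c b \<le> tc_mult I c a"
proof (cases "tc_mult I c b = 0")
  case False
  then obtain d where d: "d < c" "tc_mult I c b \<le> count I (c, d)" "(inversion_step I)\<^sup>*\<^sup>* d b"
    using le_tc_mult_iff[of "tc_mult I c b" I c b] by blast
  obtain e where e: "e < b" "1 \<le> count I (b, e)" "(inversion_step I)\<^sup>*\<^sup>* e a"
    using assms le_tc_mult_iff[of 1 I b a] by (auto simp: Suc_le_eq)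
  have "(inversion_step I)\<^sup>*\<^sup>* b a"
    using e by (intro converse_rtranclp_into_rtranclp[OF _ e(3)]) (simp add: inversion_step_def)
  then have "(inversion_step I)\<^sup>*\<^sup>* d a" using d(3) by (rule rtranclp_trans[rotated])
  then show ?thesis using d False by (subst le_tc_mult_iff) auto
qed simp

text \<open>Follow the path to the step from \<open>y\<close> to \<open>z\<close> with
  \<open>z \<le> b < y\<close>. If it skips \<open>b\<close>, planarity either makes
  \<open>(y, b)\<close> an inversion too, or makes the multiplicity of \<open>(b, z)\<close>
  maximal, and the path continues from \<open>z\<close>. The second alternative is an equation and
  not a step because \<open>part s b\<close> may be 0.\<close>

lemma path_crossing:
  assumes "(inversion_step I)\<^sup>*\<^sup>* d a" "a < b" "b < d" "b \<in> A"
  shows "(inversion_step I)\<^sup>*\<^sup>* d b \<or>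
    (\<exists>e<b. count I (b, e) = part s b \<and> (inversion_step I)\<^sup>*\<^sup>* e a)"
  using assms
proof (induction rule: converse_rtranclp_induct)
  case base
  then show ?case by simp
next
  case (step y z)
  have yz: "z < y" "0 < count I (y, z)" using step.hyps(1) by (auto simp: inversion_step_def)
  consider "b < z" | "b = z" | "z < b" by linarith
  then show ?case
  proof cases
    case 1
    then show ?thesis using step by (meson converse_rtranclp_into_rtranclp)
  next
    case 2
    then show ?thesis using step.hyps(1) by blast
  next
    case 3
    from count_planar[OF this step.prems(2,3)] show ?thesis
    proof
      assume "count I (y, z) \<le> count I (y, b)"
      then have "inversion_step I y b" using yz step.prems unfolding inversion_step_def by linarith
      then show ?thesis by blast
    qed (use 3 step.hyps(2) in blast)
  qed
qed

lemma tc_mult_planar: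
  assumes ab: "a < b" and bc: "b < c" and b: "b \<in> A"
  shows "tc_mult I b a = part s b \<or> tc_mult I c a \<le> tc_mult I c b"
proof (cases "tc_mult I c a = 0")
  case False
  then obtain d where d: "d < c" "tc_mult I c a \<le> count I (c, d)" "(inversion_step I)\<^sup>*\<^sup>* d a"
    using le_tc_mult_iff[of "tc_mult I c a" I c a] by blast
  have reroute: "tc_mult I c a \<le> tc_mult I c b"
    if "e < c" "tc_mult I c a \<le> count I (c, e)" "(inversion_step I)\<^sup>*\<^sup>* e b" for e
    using that False by (subst le_tc_mult_iff) auto
  have maximal: "tc_mult I b a = part s b"
    if "e < b" "count I (b, e) = part s b" "(inversion_step I)\<^sup>*\<^sup>* e a" for e
  proof (cases "part s b = 0")
    case True
    then show ?thesis using tc_mult_bound[of b a] by simp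
  next
    case False
    then have "part s b \<le> tc_mult I b a" using that by (subst le_tc_mult_iff) auto
    then show ?thesis using tc_mult_bound[of b a] by simp
  qed
  consider "b < d" | "b = d" | "d < b" by linarith
  then show ?thesis
  proof cases
    case 1
    then show ?thesis using path_crossing[OF d(3) ab _ b] reroute[OF d(1,2)] maximal by blast
  next
    case 2
    then show ?thesis using reroute[OF d(1,2)] by blast
  next
    \<comment> \<open>The first step itself passes over \<open>b\<close>. Rerouting changes it to a
      step from \<open>c\<close> to \<open>b\<close>, which by planarity has at least the same
      multiplicity.\<close>
    case 3
    from count_planar[OF this bc b] show ?thesis
      using maximal[OF 3 _ d(3)] reroute[OF bc _ rtranclp.rtrancl_refl] d(2) le_trans by blast
  qed
qed simp

lemma tree_like_tc_mult: "tree_like s A (tc_mult I)"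
  unfolding tree_like_def using tc_mult_bound tc_mult_transitive tc_mult_planar by (meson neq0_conv)

lemma count_le_tc_mult: "count I (c, a) \<le> tc_mult I c a"
proof (cases "count I (c, a) = 0")
  case False
  then show ?thesis using in_A by (subst le_tc_mult_iff) auto
qed simp

text \<open>The first step of a path is bounded by \<open>h\<close>. Each later step from
  \<open>y\<close> to \<open>z\<close> has \<open>0 < h y z\<close>, so transitivity of
  \<open>h\<close> gives \<open>h c y \<le> h c z\<close> and the bound travels along the
  path.\<close>

lemma tc_mult_least:
  assumes h: "tree_like s A h"
    and le: "\<And>x y. x \<in> A \<Longrightarrow> y \<in> A \<Longrightarrow> x < y \<Longrightarrow> f y x \<le> h y x \<and> g y x \<le> h y x"
  shows "tc_mult I c a \<le> h c a"
proof (cases "tc_mult I c a = 0")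
  case False
  then obtain d where d: "d < c" "tc_mult I c a \<le> count I (c, d)" "(inversion_step I)\<^sup>*\<^sup>* d a"
    using le_tc_mult_iff[of "tc_mult I c a" I c a] by blast
  have c: "c \<in> A" "d \<in> A" using d(2) False in_A[of c d] by linarith+
  have count_le: "count I (y, x) \<le> h y x" for x y unfolding count using le by simp
  have "count I (c, d) \<le> h c a \<and> a \<in> A \<and> a < c" using d(3)
  proof (induction rule: rtranclp_induct)
    case base
    then show ?case using c d(1) count_le by blast
  next
    case (step y z)
    then have "0 < h y z" "z < y" "z \<in> A"
      using in_A[of y z] count_le[of y z] unfolding inversion_step_def by linarith+
    then show ?case using step.IH tree_like_transitive[OF h, of z y c] c by auto
  qed
  then show ?thesis using d(2) by simp
qed simp

text \<open>Equality of multisets also concerns pairs outside \<open>pairs s\<close>, where tree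
  inversions have multiplicity 0.\<close>

lemma tc_mult_eq_0: "(c, a) \<notin> {(y, x). x \<in> A \<and> y \<in> A \<and> x < y} \<Longrightarrow> tc_mult I c a = 0"
proof (rule ccontr)
  assume notin: "(c, a) \<notin> {(y, x). x \<in> A \<and> y \<in> A \<and> x < y}" and "tc_mult I c a \<noteq> 0"
  then obtain d where d: "d < c" "1 \<le> count I (c, d)" "(inversion_step I)\<^sup>*\<^sup>* d a"
    using le_tc_mult_iff[of 1 I c a] by (auto simp: Suc_le_eq)
  have "c \<in> A" "d \<in> A" using d(2) in_A[of c d] by auto
  moreover have "a \<in> A" using inversion_step_rtranclp_in[OF d(3) \<open>d \<in> A\<close>] in_A by blast
  moreover have "a < c" using inversion_step_rtranclp_le[OF d(3)] d(1) by simp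
  ultimately show False using notin by blast
qed

end

section \<open>The lattice\<close>

lemma pairs_iff: "(y, x) \<in> pairs s \<longleftrightarrow> x \<in> {1..length s} \<and> y \<in> {1..length s} \<and> x < y"
  by (auto simp: pairs_def)

lemma carrier_weak_order [simp]: "carrier (weak_order s) = decreasing_trees s"
  by (simp add: weak_order_def)

lemma le_weak_order_iff:
  "R \<sqsubseteq>\<^bsub>weak_order s\<^esub> T \<longleftrightarrow> (\<forall>x\<in>{1..length s}. \<forall>y\<in>{1..length s}. x < y \<longrightarrow>
     cardinality s R y x \<le> cardinality s T y x)"
  by (auto simp: weak_order_def pairs_def)

lemma tree_like_of_decreasing:
  "T \<in> decreasing_trees s \<Longrightarrow> tree_like s {1..length s} (cardinality s T)"
  using tree_like_cardinality by (force simp: decreasing_trees_iff)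

lemma decreasing_tree_of_tree_like:
  assumes "tree_like s {1..length s} f"
  obtains T where "T \<in> decreasing_trees s"
    "\<And>x y. x \<in> {1..length s} \<Longrightarrow> y \<in> {1..length s} \<Longrightarrow> x < y \<Longrightarrow> cardinality s T y x = f y x"
  using tree_of_tree_like[OF _ assms] by (auto simp: decreasing_trees_iff)

lemma decreasing_trees_eqI:
  assumes "T \<in> decreasing_trees s" "R \<in> decreasing_trees s"
    and "\<And>x y. x \<in> {1..length s} \<Longrightarrow> y \<in> {1..length s} \<Longrightarrow> x < y \<Longrightarrow>
      cardinality s T y x = cardinality s R y x"
  shows "T = R"
  using assms unfolding decreasing_trees_iff by (intro cardinality_inject[of s]) auto

lemma finite_decreasing_trees: "finite (decreasing_trees s)"
proof (rule finite_imageD)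
  \<comment> \<open>Restricting to \<open>pairs s\<close> places the functions in a finite product,
    and a tree is still determined by its restricted function.\<close>
  let ?F = "\<lambda>T. restrict (\<lambda>(y, x). cardinality s T y x) (pairs s)"
  have "?F ` decreasing_trees s \<subseteq> (\<Pi>\<^sub>E (y, x)\<in>pairs s. {..part s y})"
    using tree_like_bound[OF tree_like_of_decreasing] by (auto simp: pairs_iff)
  then show "finite (?F ` decreasing_trees s)"
    by (rule finite_subset) (auto intro!: finite_PiE finite_pairs)
  show "inj_on ?F (decreasing_trees s)"
  proof (rule inj_onI)
    fix T R assume TR: "T \<in> decreasing_trees s" "R \<in> decreasing_trees s" and eq: "?F T = ?F R"
    have "cardinality s T y x = cardinality s R y x"
      if "x \<in> {1..length s}" "y \<in> {1..length s}" "x < y" for x y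
      using fun_cong[OF eq, of "(y, x)"] that by (simp add: pairs_iff)
    then show "T = R" using decreasing_trees_eqI[OF TR] by blast
  qed
qed

lemma partial_order_weak_order: "partial_order (weak_order s)"
proof
  show "(.=\<^bsub>weak_order s\<^esub>) = (=)" by (simp add: weak_order_def)
  fix x y assume "x \<sqsubseteq>\<^bsub>weak_order s\<^esub> y" "y \<sqsubseteq>\<^bsub>weak_order s\<^esub> x"
    "x \<in> carrier (weak_order s)" "y \<in> carrier (weak_order s)"
  then have "x = y" by (intro decreasing_trees_eqI) (auto simp: le_weak_order_iff intro: antisym)
  then show "x .=\<^bsub>weak_order s\<^esub> y" by (simp add: weak_order_def)
next
  show "x \<sqsubseteq>\<^bsub>weak_order s\<^esub> z" if "x \<sqsubseteq>\<^bsub>weak_order s\<^esub> y" "y \<sqsubseteq>\<^bsub>weak_order s\<^esub> z" for x y z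
    using that unfolding le_weak_order_iff by (meson le_trans)
qed (auto simp: weak_order_def)

lemma least_Upper_weak_order:
  assumes T: "T \<in> decreasing_trees s" and R: "R \<in> decreasing_trees s"
  obtains J where "least (weak_order s) J (Upper (weak_order s) {T, R})"
    "tree_inversions s J = tc (tree_inversions s T \<union># tree_inversions s R)"
proof -
  let ?I = "tree_inversions s T \<union># tree_inversions s R" and ?A = "{1..length s}"
  interpret join_inversions s ?A "cardinality s T" "cardinality s R" ?I
    using tree_like_of_decreasing[OF T] tree_like_of_decreasing[OF R]
    by unfold_locales (simp_all add: count_tree_inversions pairs_iff)
  obtain J where J: "J \<in> decreasing_trees s"
    "\<And>x y. x \<in> ?A \<Longrightarrow> y \<in> ?A \<Longrightarrow> x < y \<Longrightarrow> cardinality s J y x = tc_mult ?I y x"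
    using decreasing_tree_of_tree_like[OF tree_like_tc_mult] by blast
  have "J \<in> Upper (weak_order s) {T, R}"
  proof -
    have "max (cardinality s T y x) (cardinality s R y x) \<le> cardinality s J y x"
      if "x \<in> ?A" "y \<in> ?A" "x < y" for x y
      using count_le_tc_mult[of y x] J(2)[OF that] that unfolding count by simp
    then show ?thesis using J(1) by (auto simp: Upper_def le_weak_order_iff)
  qed
  moreover have "J \<sqsubseteq>\<^bsub>weak_order s\<^esub> U" if "U \<in> Upper (weak_order s) {T, R}" for U
  proof -
    have U: "U \<in> decreasing_trees s" "T \<sqsubseteq>\<^bsub>weak_order s\<^esub> U" "R \<sqsubseteq>\<^bsub>weak_order s\<^esub> U"
      using that T R by (auto simp: Upper_def)
    have "tc_mult ?I y x \<le> cardinality s U y x" for x y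
      using U(2,3) by (intro tc_mult_least tree_like_of_decreasing U) (auto simp: le_weak_order_iff)
    then show ?thesis using J(2) by (simp add: le_weak_order_iff)
  qed
  ultimately have "least (weak_order s) J (Upper (weak_order s) {T, R})"
    unfolding least_def using Upper_closed by blast
  moreover have "tree_inversions s J = tc ?I"
  proof (rule multiset_eqI)
    fix p :: "nat \<times> nat"
    obtain y x where p: "p = (y, x)" by (cases p)
    show "Multiset.count (tree_inversions s J) p = Multiset.count (tc ?I) p"
      unfolding p count_tc count_tree_inversions
      using J(2) tc_mult_eq_0[of y x] by (auto simp: pairs_iff)
  qed
  ultimately show ?thesis by (rule that)
qed

lemma upper_semilattice_weak_order: "upper_semilattice (weak_order s)"
  by (intro upper_semilattice.intro partial_order_weak_order upper_semilattice_axioms.intro)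
    (metis carrier_weak_order least_Upper_weak_order)

text \<open>The meet is the join of all common lower bounds, which are finitely many.\<close>

lemma lattice_weak_order: "lattice (weak_order s)"
proof -
  interpret upper_semilattice "weak_order s" by (rule upper_semilattice_weak_order)
  have "\<exists>M. greatest (weak_order s) M (Lower (weak_order s) {T, R})"
    if TR: "T \<in> decreasing_trees s" "R \<in> decreasing_trees s" for T R
  proof -
    let ?L = "Lower (weak_order s) {T, R}"
    have sub: "?L \<subseteq> carrier (weak_order s)" by (rule Lower_closed)
    \<comment> \<open>The zero function gives a bottom element, so the set of common lower bounds is
      nonempty and its supremum exists.\<close>
    have "tree_like s {1..length s} (\<lambda>y x. 0)" by (simp add: tree_like_def)
    then obtain Z where Z: "Z \<in> decreasing_trees s"
      "\<And>x y. x \<in> {1..length s} \<Longrightarrow> y \<in> {1..length s} \<Longrightarrow> x < y \<Longrightarrow> cardinality s Z y x = 0"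
      using decreasing_tree_of_tree_like by blast
    then have "Z \<in> ?L" by (auto simp: Lower_def le_weak_order_iff)
    then have "least (weak_order s) (\<Squnion>\<^bsub>weak_order s\<^esub> ?L) (Upper (weak_order s) ?L)"
      using sub finite_subset[OF sub] finite_decreasing_trees by (intro finite_sup_least) auto
    \<comment> \<open>As \<open>T\<close> and \<open>R\<close> bound all of \<open>?L\<close> from
      above, the supremum of \<open>?L\<close> lies below both and hence belongs to
      \<open>?L\<close>.\<close>
    moreover have "{T, R} \<subseteq> Upper (weak_order s) ?L" using TR by (auto simp: Lower_def Upper_def)
    ultimately have "greatest (weak_order s) (\<Squnion>\<^bsub>weak_order s\<^esub> ?L) ?L"
      using TR sub least_closed[of "weak_order s"]
      by (intro greatest_LowerI) (auto intro: least_le least_Upper_above)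
    then show ?thesis by blast
  qed
  then show ?thesis by unfold_locales simp
qed

theorem theorem1p21:
  fixes s :: "nat list"
  shows "lattice (weak_order s) \<and>
    (\<forall>T\<in>decreasing_trees s. \<forall>R\<in>decreasing_trees s.
       T \<squnion>\<^bsub>weak_order s\<^esub> R \<in> decreasing_trees s \<and>
       tree_inversions s (T \<squnion>\<^bsub>weak_order s\<^esub> R)
         = tc (tree_inversions s T \<union># tree_inversions s R))"
proof (intro conjI ballI lattice_weak_order)
  interpret upper_semilattice "weak_order s" by (rule upper_semilattice_weak_order)
  fix T R assume TR: "T \<in> decreasing_trees s" "R \<in> decreasing_trees s"
  then show "T \<squnion>\<^bsub>weak_order s\<^esub> R \<in> decreasing_trees s"
    using join_closed[of T R] by simp
  obtain J where J: "least (weak_order s) J (Upper (weak_order s) {T, R})"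
    "tree_inversions s J = tc (tree_inversions s T \<union># tree_inversions s R)"
    using least_Upper_weak_order[OF TR] .
  have "T \<squnion>\<^bsub>weak_order s\<^esub> R = J"
    by (rule joinI) (use TR J(1) in \<open>auto intro: least_unique\<close>)
  then show "tree_inversions s (T \<squnion>\<^bsub>weak_order s\<^esub> R) =
      tc (tree_inversions s T \<union># tree_inversions s R)"
    using J(2) by simp
qed

end
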